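(* Let $R$ be a commutative unital ring, $C_\ast: C_0\xleftarrow{\partial_1}C_1\leftarrow\cdots\xleftarrow{\partial_N}C_N$ a chain complex of free $R$-modules of finite rank, and $I_k$ a fixed basis of $C_k$ for each $k$. (a) For every choice of total orders $\leq_k$ on the sets $I_k$, with $\leq\,=\bigcup_k\leq_k$, the set $\mathcal{M}_\leq$ (the steepness pairing associated to $\leq$) is a Morse matching on $\Gamma_{C_\ast}$. (b) Every Morse matching on $\Gamma_{C_\ast}$ is a subset of $\mathcal{M}_\leq$ for some choice of total orders $\leq_k$ on the $I_k$. Consequently, every Morse matching on $\Gamma_{C_\ast}$ that is maximal with respect to inclusion is equal to some steepness pairing $\mathcal{M}_\leq$: $$\{\text{maximal Morse matchings on }\Gamma_{C_\ast}\}\subseteq\{\text{steepness pairings on }\Gamma_{C_\ast}\}.$$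
   Context: The digraph $\Gamma_{C_\ast}$ has vertex set the disjoint union $\bigsqcup_k I_k$, and for each nonzero entry $\partial_{k,u,v}=w\in R\setminus\{0\}$ of the matrix of $\partial_k$ (row $u\in I_{k-1}$, column $v\in I_k$) a directed edge from $v$ to $u$ of weight $w$, written $u\xleftarrow{w}v$ or $u\leftarrow v$. A set $\mathcal{M}$ of edges of $\Gamma_{C_\ast}$ is a Morse matching if: (1) distinct edges in $\mathcal{M}$ have no common vertex; (2) the weight $w$ of each edge $u\xleftarrow{w}v$ in $\mathcal{M}$ is invertible in $R$; (3) the digraph $\Gamma^{\mathcal{M}}_{C_\ast}$, obtained from $\Gamma_{C_\ast}$ by replacing each edge $u\xleftarrow{w}v$ in $\mathcal{M}$ by the reversed edge $u\to v$ with weight $-1/w$, contains no directed cycles and no infinite paths $u_1\to v_1\to u_2\to v_2\to\cdots$ with all $u_1,u_2,\ldots$ in one $I_k$. Given total orders $\leq_k$ on $I_k$, the steepness pairing $\mathcal{M}_\leq$ is the set of all edges $u\xleftarrow{w}v$ of $\Gamma_{C_\ast}$ such that $w$ is a unit of $R$, every edge $x\leftarrow v$ with $x\neq u$ satisfies $x<u$, and every edge $u\leftarrow y$ with $y\neq v$ satisfies $v<y$. *)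

theory Defs
  imports "HOL-Algebra.Module" "HOL-Library.FuncSet" "Graph_Theory.Arc_Walk"
begin

definition is_lin_comb ::
  "('a, 'm) ring_scheme \<Rightarrow> ('a, 'b, 'n) module_scheme \<Rightarrow> 'b set \<Rightarrow> 'b \<Rightarrow> ('b \<Rightarrow> 'a) \<Rightarrow> bool"
  where "is_lin_comb R M B x c \<longleftrightarrow>
    c \<in> B \<rightarrow>\<^sub>E carrier R \<and> x = (\<Oplus>\<^bsub>M\<^esub>b\<in>B. c b \<odot>\<^bsub>M\<^esub> b)"

definition finite_basis ::
  "('a, 'm) ring_scheme \<Rightarrow> ('a, 'b, 'n) module_scheme \<Rightarrow> 'b set \<Rightarrow> bool"
  where "finite_basis R M B \<longleftrightarrow>
    finite B \<and> B \<subseteq> carrier M \<and> (\<forall>x\<in>carrier M. \<exists>!c. is_lin_comb R M B x c)"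

definition coord ::
  "('a, 'm) ring_scheme \<Rightarrow> ('a, 'b, 'n) module_scheme \<Rightarrow> 'b set \<Rightarrow> 'b \<Rightarrow> 'b \<Rightarrow> 'a"
  where "coord R M B x = (THE c. is_lin_comb R M B x c)"

definition linear_maps ::
  "('a, 'm) ring_scheme \<Rightarrow> ('a, 'b, 'n) module_scheme \<Rightarrow> ('a, 'c, 'p) module_scheme \<Rightarrow> ('b \<Rightarrow> 'c) set"
  where "linear_maps R M M' = {f \<in> carrier M \<rightarrow> carrier M'.
    (\<forall>x\<in>carrier M. \<forall>y\<in>carrier M. f (x \<oplus>\<^bsub>M\<^esub> y) = f x \<oplus>\<^bsub>M'\<^esub> f y) \<and>
    (\<forall>a\<in>carrier R. \<forall>x\<in>carrier M. f (a \<odot>\<^bsub>M\<^esub> x) = a \<odot>\<^bsub>M'\<^esub> f x)}"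

text \<open>
  The complex lives in degrees \<open>0..N\<close>, with \<open>d (Suc k)\<close> the boundary map from degree \<open>Suc k\<close>
  to degree \<open>k\<close>; values of \<open>C\<close>, \<open>d\<close> and \<open>I\<close> outside this range (in particular \<open>d 0\<close>) are
  irrelevant. That all \<open>C k\<close> have carriers in one type is no restriction, since the carriers
  are otherwise unrelated. The ring may be the zero ring.
\<close>

locale based_chain_complex = R?: cring R
  for R :: "('a, 'm) ring_scheme" (structure)
    and C :: "nat \<Rightarrow> ('a, 'b, 'n) module_scheme"
    and N :: nat
    and d :: "nat \<Rightarrow> 'b \<Rightarrow> 'b"
    and I :: "nat \<Rightarrow> 'b set" +
  assumes module_C: "k \<le> N \<Longrightarrow> Module.module R (C k)"
    and basis_I: "k \<le> N \<Longrightarrow> finite_basis R (C k) (I k)"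
    and boundary_linear: "k < N \<Longrightarrow> d (Suc k) \<in> linear_maps R (C (Suc k)) (C k)"
    and boundary_boundary: "\<lbrakk>Suc k < N; x \<in> carrier (C (Suc (Suc k)))\<rbrakk> \<Longrightarrow>
      d (Suc k) (d (Suc (Suc k)) x) = \<zero>\<^bsub>C k\<^esub>"

definition boundary_entry ::
  "('a, 'm) ring_scheme \<Rightarrow> (nat \<Rightarrow> ('a, 'b, 'n) module_scheme) \<Rightarrow> (nat \<Rightarrow> 'b \<Rightarrow> 'b)
    \<Rightarrow> (nat \<Rightarrow> 'b set) \<Rightarrow> nat \<Rightarrow> 'b \<Rightarrow> 'b \<Rightarrow> 'a"
  where "boundary_entry R C d I k u v = coord R (C (k - 1)) (I (k - 1)) (d k v) u"

text \<open>
  A vertex is a pair of a degree and a basis element, which makes the union of the bases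
  disjoint. An arc is a triple (tail, weight, head).
\<close>

type_synonym 'b vertex = "nat \<times> 'b"
type_synonym ('a, 'b) warc = "'b vertex \<times> 'a \<times> 'b vertex"
type_synonym ('a, 'b) wgraph = "('b vertex, ('a, 'b) warc) pre_digraph"

definition complex_digraph ::
  "('a, 'm) ring_scheme \<Rightarrow> (nat \<Rightarrow> ('a, 'b, 'n) module_scheme) \<Rightarrow> nat \<Rightarrow> (nat \<Rightarrow> 'b \<Rightarrow> 'b)
    \<Rightarrow> (nat \<Rightarrow> 'b set) \<Rightarrow> ('a, 'b) wgraph"
  where "complex_digraph R C N d I =
    \<lparr>verts = (SIGMA k:{0..N}. I k),
     arcs = {((k, v), w, (k - 1, u)) | k u v w.
       k \<in> {1..N} \<and> u \<in> I (k - 1) \<and> v \<in> I k \<and> w = boundary_entry R C d I k u v \<and> w \<noteq> \<zero>\<^bsub>R\<^esub>},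
     tail = (\<lambda>(v, w, u). v),
     head = (\<lambda>(v, w, u). u)\<rparr>"

definition reverse_arcs ::
  "('a, 'm) ring_scheme \<Rightarrow> ('a, 'b) wgraph \<Rightarrow> ('a, 'b) warc set \<Rightarrow> ('a, 'b) wgraph"
  where "reverse_arcs R G M =
    G\<lparr>arcs := (arcs G - M) \<union> {(u, \<ominus>\<^bsub>R\<^esub> (inv\<^bsub>R\<^esub> w), v) | u w v. (v, w, u) \<in> M}\<rparr>"

text \<open>
  In the last condition the vertices \<open>p 0, p 2, p 4, \<dots>\<close> are the \<open>u\<^sub>1, u\<^sub>2, u\<^sub>3, \<dots>\<close> of an infinite
  directed path \<open>u\<^sub>1 \<rightarrow> v\<^sub>1 \<rightarrow> u\<^sub>2 \<rightarrow> v\<^sub>2 \<rightarrow> \<dots>\<close>; they belong to the basis in degree \<open>k\<close> iff their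
  first component is \<open>k\<close>. Vertices of a path may repeat.
\<close>

definition morse_matching ::
  "('a, 'm) ring_scheme \<Rightarrow> ('a, 'b) wgraph \<Rightarrow> ('a, 'b) warc set \<Rightarrow> bool"
  where "morse_matching R G M \<longleftrightarrow>
    M \<subseteq> arcs G \<and>
    (\<forall>e\<in>M. \<forall>f\<in>M. e \<noteq> f \<longrightarrow> {tail G e, head G e} \<inter> {tail G f, head G f} = {}) \<and>
    (\<forall>(v, w, u)\<in>M. w \<in> Units R) \<and>
    (\<nexists>p. pre_digraph.cycle (reverse_arcs R G M) p) \<and>
    (\<nexists>p k. (\<forall>i. (p i, p (Suc i)) \<in> arcs_ends (reverse_arcs R G M)) \<and>
      (\<forall>i. fst (p (2 * i)) = k))"

definition maximal_morse_matching ::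
  "('a, 'm) ring_scheme \<Rightarrow> ('a, 'b) wgraph \<Rightarrow> ('a, 'b) warc set \<Rightarrow> bool"
  where "maximal_morse_matching R G M \<longleftrightarrow>
    morse_matching R G M \<and> (\<forall>M'. morse_matching R G M' \<and> M \<subseteq> M' \<longrightarrow> M' = M)"

definition total_orders :: "nat \<Rightarrow> (nat \<Rightarrow> 'b set) \<Rightarrow> (nat \<Rightarrow> 'b rel) \<Rightarrow> bool"
  where "total_orders N I ords \<longleftrightarrow> (\<forall>k\<le>N. linear_order_on (I k) (ords k))"

definition order_union :: "nat \<Rightarrow> (nat \<Rightarrow> 'b rel) \<Rightarrow> 'b vertex rel"
  where "order_union N ords = {((k, x), (k, y)) | k x y. k \<le> N \<and> (x, y) \<in> ords k}"

text \<open>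
  The relation \<open>r\<close> is the reflexive order; membership in \<open>r\<close> together with the inequality
  of the two vertices expresses the strict order.
\<close>

definition steepness_pairing ::
  "('a, 'm) ring_scheme \<Rightarrow> ('a, 'b) wgraph \<Rightarrow> 'b vertex rel \<Rightarrow> ('a, 'b) warc set"
  where "steepness_pairing R G r = {(v, w, u) \<in> arcs G.
    w \<in> Units R \<and>
    (\<forall>x w'. (v, w', x) \<in> arcs G \<and> x \<noteq> u \<longrightarrow> (x, u) \<in> r - Id) \<and>
    (\<forall>y w'. (y, w', u) \<in> arcs G \<and> y \<noteq> v \<longrightarrow> (v, y) \<in> r - Id)}"

end

theory Submission
  imports Defs
begin

text \<open>
  Write \<open>\<Gamma>\<close> for the digraph of the complex and \<open>\<Gamma>\<^sup>M\<close> for the digraph with the arcs of \<open>M\<close> reversed.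

  The last two conditions on a Morse matching amount to the absence of infinite walks in \<open>\<Gamma>\<^sup>M\<close>
  (\<open>morse_matching_iff_wf\<close>). A walk in \<open>\<Gamma>\<^sup>M\<close> never goes up twice in a row, because the two reversed
  arcs would share a vertex; so the degree never increases over two steps, and every infinite walk
  eventually alternates between two adjacent degrees. Repeating a cycle forever
  also gives an infinite walk.

  For part (a), any two steps \<open>x \<rightarrow> y \<rightarrow> z\<close> of \<open>\<Gamma>\<^sup>M\<close> with \<open>x\<close> and \<open>z\<close> of equal degree use one
  reversed arc of the steepness pairing and one ordinary arc at \<open>y\<close>, and steepness at \<open>y\<close> says that
  \<open>z < x\<close>. So an infinite alternating walk would be an infinite descent in a finite order. Steep arcs
  sharing a head or sharing a tail coincide by antisymmetry of the order. The one place where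
  \<open>\<partial>\<^sup>2 = 0\<close> enters is the remaining case of two consecutive steep arcs \<open>u \<leftarrow> v \<leftarrow> y\<close>: steepness
  leaves \<open>v\<close> as the only middle vertex contributing to the \<open>(u, y)\<close> entry of \<open>\<partial>\<^sup>2\<close>, so a product of two
  units would vanish, and with it the weights themselves, which are nonzero.

  For part (b), reachability in \<open>\<Gamma>\<^sup>M\<close> is a strict partial order on finitely many vertices; extend
  it to a total order in which walks descend. If \<open>v \<rightarrow> u\<close> is in \<open>M\<close> and \<open>v \<rightarrow> x\<close>, \<open>y \<rightarrow> u\<close> are
  other arcs, then \<open>\<Gamma>\<^sup>M\<close> contains \<open>u \<rightarrow> v \<rightarrow> x\<close> and \<open>y \<rightarrow> u \<rightarrow> v\<close>, so \<open>x < u\<close> and \<open>v < y\<close>; that is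
  steepness. The statement on maximal matchings combines both parts.
\<close>

section \<open>Coordinates and the product of consecutive boundary matrices\<close>

lemma coord_is_lin_comb:
  assumes "finite_basis R M B" "x \<in> carrier M"
  shows "is_lin_comb R M B x (coord R M B x)"
proof -
  have "\<exists>!c. is_lin_comb R M B x c"
    using assms by (simp add: finite_basis_def)
  then show ?thesis unfolding coord_def by (rule theI')
qed

lemma is_lin_comb_unique:
  assumes "finite_basis R M B" "x \<in> carrier M" "is_lin_comb R M B x c" "is_lin_comb R M B x c'"
  shows "c = c'"
proof -
  have "\<exists>!c. is_lin_comb R M B x c"
    using assms(1,2) by (simp add: finite_basis_def)
  with assms(3,4) show ?thesis by blast
qed

context Module.module
begin

lemma is_lin_comb_closed:
  assumes "is_lin_comb R M B x c" "B \<subseteq> carrier M"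
  shows "x \<in> carrier M"
proof -
  have "(\<lambda>b. c b \<odot>\<^bsub>M\<^esub> b) \<in> B \<rightarrow> carrier M"
    using assms by (auto simp: is_lin_comb_def intro!: smult_closed)
  then show ?thesis using assms(1) by (simp add: is_lin_comb_def)
qed

lemma is_lin_comb_zero:
  assumes "B \<subseteq> carrier M"
  shows "is_lin_comb R M B \<zero>\<^bsub>M\<^esub> (\<lambda>b\<in>B. \<zero>)"
proof -
  have "(\<Oplus>\<^bsub>M\<^esub>b\<in>B. (\<lambda>b\<in>B. \<zero>) b \<odot>\<^bsub>M\<^esub> b) = (\<Oplus>\<^bsub>M\<^esub>b\<in>B. \<zero>\<^bsub>M\<^esub>)"
    using assms by (intro M.finsum_cong') auto
  then show ?thesis by (auto simp: is_lin_comb_def)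
qed

lemma is_lin_comb_add:
  assumes B: "B \<subseteq> carrier M" and x: "is_lin_comb R M B x c" and y: "is_lin_comb R M B y e"
  shows "is_lin_comb R M B (x \<oplus>\<^bsub>M\<^esub> y) (\<lambda>b\<in>B. c b \<oplus> e b)"
proof -
  have ce: "c b \<in> carrier R" "e b \<in> carrier R" "b \<in> carrier M" if "b \<in> B" for b
    using x y B that by (auto simp: is_lin_comb_def)
  have "(\<Oplus>\<^bsub>M\<^esub>b\<in>B. (\<lambda>b\<in>B. c b \<oplus> e b) b \<odot>\<^bsub>M\<^esub> b) = (\<Oplus>\<^bsub>M\<^esub>b\<in>B. c b \<odot>\<^bsub>M\<^esub> b \<oplus>\<^bsub>M\<^esub> e b \<odot>\<^bsub>M\<^esub> b)"
    using ce by (intro M.finsum_cong') (auto simp: smult_l_distr)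
  also have "\<dots> = (\<Oplus>\<^bsub>M\<^esub>b\<in>B. c b \<odot>\<^bsub>M\<^esub> b) \<oplus>\<^bsub>M\<^esub> (\<Oplus>\<^bsub>M\<^esub>b\<in>B. e b \<odot>\<^bsub>M\<^esub> b)"
    using ce by (intro M.finsum_addf) auto
  finally show ?thesis using x y ce by (auto simp: is_lin_comb_def)
qed

lemma is_lin_comb_smult:
  assumes B: "B \<subseteq> carrier M" "finite B" and x: "is_lin_comb R M B x c" and a: "a \<in> carrier R"
  shows "is_lin_comb R M B (a \<odot>\<^bsub>M\<^esub> x) (\<lambda>b\<in>B. a \<otimes> c b)"
proof -
  have c: "c b \<in> carrier R" "b \<in> carrier M" if "b \<in> B" for b
    using x B that by (auto simp: is_lin_comb_def)
  have "(\<Oplus>\<^bsub>M\<^esub>b\<in>B. (\<lambda>b\<in>B. a \<otimes> c b) b \<odot>\<^bsub>M\<^esub> b) = (\<Oplus>\<^bsub>M\<^esub>b\<in>B. a \<odot>\<^bsub>M\<^esub> (c b \<odot>\<^bsub>M\<^esub> b))"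
    using c a by (intro M.finsum_cong') (auto simp: smult_assoc1)
  also have "\<dots> = a \<odot>\<^bsub>M\<^esub> (\<Oplus>\<^bsub>M\<^esub>b\<in>B. c b \<odot>\<^bsub>M\<^esub> b)"
    using c a B(2) by (intro finsum_smult_ldistr[symmetric]) auto
  finally show ?thesis using x c a by (auto simp: is_lin_comb_def)
qed

lemma is_lin_comb_finsum:
  assumes B: "B \<subseteq> carrier M" "finite B" and "finite A"
    and "\<And>a. a \<in> A \<Longrightarrow> c a \<in> carrier R" "\<And>a. a \<in> A \<Longrightarrow> is_lin_comb R M B (g a) (e a)"
  shows "is_lin_comb R M B (\<Oplus>\<^bsub>M\<^esub>a\<in>A. c a \<odot>\<^bsub>M\<^esub> g a) (\<lambda>b\<in>B. \<Oplus>a\<in>A. c a \<otimes> e a b)"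
  using assms(3-)
proof (induction A)
  case empty
  show ?case
    unfolding M.finsum_empty R.finsum_empty by (rule is_lin_comb_zero[OF B(1)])
next
  case (insert a A)
  have g: "g x \<in> carrier M" if "x \<in> insert a A" for x
    using is_lin_comb_closed[OF _ B(1)] insert.prems(2) that by blast
  have e: "e x b \<in> carrier R" if "x \<in> insert a A" "b \<in> B" for x b
    using insert.prems(2)[OF that(1)] that(2) by (auto simp: is_lin_comb_def)
  have "is_lin_comb R M B (c a \<odot>\<^bsub>M\<^esub> g a) (\<lambda>b\<in>B. c a \<otimes> e a b)"
    using B insert.prems by (intro is_lin_comb_smult) auto
  moreover have "is_lin_comb R M B (\<Oplus>\<^bsub>M\<^esub>x\<in>A. c x \<odot>\<^bsub>M\<^esub> g x) (\<lambda>b\<in>B. \<Oplus>x\<in>A. c x \<otimes> e x b)"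
    using insert.prems by (intro insert.IH) auto
  ultimately have "is_lin_comb R M B (c a \<odot>\<^bsub>M\<^esub> g a \<oplus>\<^bsub>M\<^esub> (\<Oplus>\<^bsub>M\<^esub>x\<in>A. c x \<odot>\<^bsub>M\<^esub> g x))
    (\<lambda>b\<in>B. (\<lambda>b\<in>B. c a \<otimes> e a b) b \<oplus> (\<lambda>b\<in>B. \<Oplus>x\<in>A. c x \<otimes> e x b) b)"
    by (rule is_lin_comb_add[OF B(1)])
  moreover have "(\<Oplus>\<^bsub>M\<^esub>x\<in>insert a A. c x \<odot>\<^bsub>M\<^esub> g x) = c a \<odot>\<^bsub>M\<^esub> g a \<oplus>\<^bsub>M\<^esub> (\<Oplus>\<^bsub>M\<^esub>x\<in>A. c x \<odot>\<^bsub>M\<^esub> g x)"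
    using insert.hyps insert.prems(1) g by (intro M.finsum_insert) auto
  moreover have "(\<Oplus>x\<in>insert a A. c x \<otimes> e x b) = c a \<otimes> e a b \<oplus> (\<Oplus>x\<in>A. c x \<otimes> e x b)"
    if "b \<in> B" for b
    using insert.hyps insert.prems(1) e that by (intro R.finsum_insert) auto
  ultimately show ?case by (simp add: restrict_def cong: if_cong)
qed

end

lemma linear_map_finsum:
  assumes M: "Module.module R M" and M': "Module.module R M'" and f: "f \<in> linear_maps R M M'"
    and "finite A" "\<And>a. a \<in> A \<Longrightarrow> c a \<in> carrier R" "\<And>a. a \<in> A \<Longrightarrow> g a \<in> carrier M"
  shows "f (\<Oplus>\<^bsub>M\<^esub>a\<in>A. c a \<odot>\<^bsub>M\<^esub> g a) = (\<Oplus>\<^bsub>M'\<^esub>a\<in>A. c a \<odot>\<^bsub>M'\<^esub> f (g a))"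
  using assms(4-)
proof (induction A)
  interpret M: Module.module R M by fact
  interpret M': Module.module R M' by fact
  have f_carrier: "f x \<in> carrier M'" if "x \<in> carrier M" for x
    using f that by (auto simp: linear_maps_def)
  have f_smult: "f (a \<odot>\<^bsub>M\<^esub> x) = a \<odot>\<^bsub>M'\<^esub> f x" if "a \<in> carrier R" "x \<in> carrier M" for a x
    using f that by (auto simp: linear_maps_def)
  have f_add: "f (x \<oplus>\<^bsub>M\<^esub> y) = f x \<oplus>\<^bsub>M'\<^esub> f y" if "x \<in> carrier M" "y \<in> carrier M" for x y
    using f that by (auto simp: linear_maps_def)
  {
    case empty
    have "f \<zero>\<^bsub>M\<^esub> = \<zero>\<^bsub>M'\<^esub>"
      using f_smult[of "\<zero>\<^bsub>R\<^esub>" "\<zero>\<^bsub>M\<^esub>"] f_carrier by simp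
    then show ?case by simp
  next
    case (insert a A)
    have "f (\<Oplus>\<^bsub>M\<^esub>x\<in>insert a A. c x \<odot>\<^bsub>M\<^esub> g x) = f (c a \<odot>\<^bsub>M\<^esub> g a \<oplus>\<^bsub>M\<^esub> (\<Oplus>\<^bsub>M\<^esub>x\<in>A. c x \<odot>\<^bsub>M\<^esub> g x))"
      using insert by (subst M.finsum_insert) auto
    also have "\<dots> = f (c a \<odot>\<^bsub>M\<^esub> g a) \<oplus>\<^bsub>M'\<^esub> f (\<Oplus>\<^bsub>M\<^esub>x\<in>A. c x \<odot>\<^bsub>M\<^esub> g x)"
      using insert.prems by (intro f_add M.finsum_closed) auto
    also have "\<dots> = c a \<odot>\<^bsub>M'\<^esub> f (g a) \<oplus>\<^bsub>M'\<^esub> (\<Oplus>\<^bsub>M'\<^esub>x\<in>A. c x \<odot>\<^bsub>M'\<^esub> f (g x))"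
      using insert by (simp add: f_smult)
    also have "\<dots> = (\<Oplus>\<^bsub>M'\<^esub>x\<in>insert a A. c x \<odot>\<^bsub>M'\<^esub> f (g x))"
      using insert f_carrier by (subst M'.finsum_insert) auto
    finally show ?case .
  }
qed

context based_chain_complex
begin

lemma finite_I: "k \<le> N \<Longrightarrow> finite (I k)"
  and I_carrier: "k \<le> N \<Longrightarrow> v \<in> I k \<Longrightarrow> v \<in> carrier (C k)"
  using basis_I by (auto simp: finite_basis_def)

lemma boundary_carrier:
  "k < N \<Longrightarrow> x \<in> carrier (C (Suc k)) \<Longrightarrow> d (Suc k) x \<in> carrier (C k)"
  using boundary_linear[of k] by (auto simp: linear_maps_def)

lemma is_lin_comb_boundary:
  assumes "k < N" "v \<in> I (Suc k)"
  shows "is_lin_comb R (C k) (I k) (d (Suc k) v) (\<lambda>u. boundary_entry R C d I (Suc k) u v)"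
  using coord_is_lin_comb[OF basis_I[of k] boundary_carrier[OF _ I_carrier], of v] assms
  by (simp add: boundary_entry_def)

lemma boundary_entry_carrier:
  assumes "k < N" "v \<in> I (Suc k)" "u \<in> I k"
  shows "boundary_entry R C d I (Suc k) u v \<in> carrier R"
  using is_lin_comb_boundary[OF assms(1,2)] assms(3) by (auto simp: is_lin_comb_def)

text \<open>
  This is \<open>\<partial>\<^sup>2 = 0\<close> read off in coordinates: expanding both boundaries yields an expression of \<open>0\<close> as a
  linear combination of basis elements, which has to be the trivial one.
\<close>

lemma boundary_entry_product:
  assumes k: "Suc k < N" and v: "v \<in> I (Suc (Suc k))" and u: "u \<in> I k"
  shows "(\<Oplus>x\<in>I (Suc k). boundary_entry R C d I (Suc (Suc k)) x v \<otimes>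
    boundary_entry R C d I (Suc k) u x) = \<zero>"
proof -
  let ?c = "\<lambda>x. boundary_entry R C d I (Suc (Suc k)) x v"
  let ?e = "\<lambda>x u. boundary_entry R C d I (Suc k) u x"
  interpret Ck: Module.module R "C k" using k by (intro module_C) simp
  interpret CSk: Module.module R "C (Suc k)" using k by (intro module_C) simp
  have c: "?c x \<in> carrier R" if "x \<in> I (Suc k)" for x
    using boundary_entry_carrier[OF k v that] .
  have dv: "d (Suc (Suc k)) v = (\<Oplus>\<^bsub>C (Suc k)\<^esub>x\<in>I (Suc k). ?c x \<odot>\<^bsub>C (Suc k)\<^esub> x)"
    using is_lin_comb_boundary[OF k v] by (simp add: is_lin_comb_def)
  have "\<zero>\<^bsub>C k\<^esub> = d (Suc k) (d (Suc (Suc k)) v)"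
    using boundary_boundary[OF k] I_carrier[OF _ v] k by simp
  also have "\<dots> = (\<Oplus>\<^bsub>C k\<^esub>x\<in>I (Suc k). ?c x \<odot>\<^bsub>C k\<^esub> d (Suc k) x)"
    unfolding dv
  proof (rule linear_map_finsum)
    show "d (Suc k) \<in> linear_maps R (C (Suc k)) (C k)" using k by (intro boundary_linear) simp
  qed (use k c I_carrier finite_I CSk.module_axioms Ck.module_axioms in auto)
  finally have zero: "\<zero>\<^bsub>C k\<^esub> = (\<Oplus>\<^bsub>C k\<^esub>x\<in>I (Suc k). ?c x \<odot>\<^bsub>C k\<^esub> d (Suc k) x)" .
  have "is_lin_comb R (C k) (I k) (\<Oplus>\<^bsub>C k\<^esub>x\<in>I (Suc k). ?c x \<odot>\<^bsub>C k\<^esub> d (Suc k) x)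
    (\<lambda>b\<in>I k. \<Oplus>x\<in>I (Suc k). ?c x \<otimes> ?e x b)"
    using k c I_carrier finite_I is_lin_comb_boundary by (intro Ck.is_lin_comb_finsum) auto
  moreover have "is_lin_comb R (C k) (I k) \<zero>\<^bsub>C k\<^esub> (\<lambda>b\<in>I k. \<zero>)"
    using k I_carrier by (intro Ck.is_lin_comb_zero) auto
  ultimately have "(\<lambda>b\<in>I k. \<Oplus>x\<in>I (Suc k). ?c x \<otimes> ?e x b) = (\<lambda>b\<in>I k. \<zero>)"
    using k zero by (intro is_lin_comb_unique[OF basis_I[of k] Ck.M.zero_closed]) auto
  then show ?thesis using u by (metis (no_types, lifting) restrict_apply')
qed

end

section \<open>Morse matchings on graded digraphs\<close>

definition vertex_disjoint :: "('a, 'b) wgraph \<Rightarrow> ('a, 'b) warc set \<Rightarrow> bool"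
  where "vertex_disjoint G M \<longleftrightarrow>
    (\<forall>e\<in>M. \<forall>f\<in>M. e \<noteq> f \<longrightarrow> {tail G e, head G e} \<inter> {tail G f, head G f} = {})"

lemma cas_imp_trancl:
  assumes "pre_digraph.cas G u p v" "set p \<subseteq> arcs G" "p \<noteq> []"
  shows "(u, v) \<in> (arcs_ends G)\<^sup>+"
  using assms
proof (induction p arbitrary: u)
  case (Cons e p)
  have e: "(u, head G e) \<in> arcs_ends G"
    using Cons.prems by (auto simp: arcs_ends_conv pre_digraph.cas.simps)
  show ?case
  proof (cases "p = []")
    case True
    then show ?thesis using Cons.prems e by (auto simp: pre_digraph.cas.simps)
  next
    case False
    then have "(head G e, v) \<in> (arcs_ends G)\<^sup>+"
      using Cons by (auto simp: pre_digraph.cas.simps)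
    with e show ?thesis by (rule trancl_into_trancl2)
  qed
qed simp

lemma wf_imp_no_cycle:
  assumes "wf ((arcs_ends G)\<inverse>)"
  shows "\<not> pre_digraph.cycle G p"
proof
  assume "pre_digraph.cycle G p"
  then obtain u where "(u, u) \<in> (arcs_ends G)\<^sup>+"
    by (auto simp: pre_digraph.cycle_def pre_digraph.awalk_def intro: cas_imp_trancl)
  with wf_acyclic[OF assms] show False by (auto simp: acyclic_def trancl_converse)
qed

text \<open>
  Arcs lower the degree by one, and there are no parallel arcs. The latter makes a walk
  unable to undo a reversed arc at once: after \<open>u \<rightarrow> v\<close> with \<open>v \<rightarrow> u\<close> in the matching, the next
  vertex differs from \<open>u\<close>.
\<close>

locale graded_digraph =
  fixes R :: "('a, 'm) ring_scheme" and G :: "('a, 'b) wgraph"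
  assumes tail_G: "tail G = (\<lambda>(v, w, u). v)"
    and head_G: "head G = (\<lambda>(v, w, u). u)"
    and arc_degree: "(v, w, u) \<in> arcs G \<Longrightarrow> fst v = Suc (fst u)"
    and arc_weight_unique: "(v, w, u) \<in> arcs G \<Longrightarrow> (v, w', u) \<in> arcs G \<Longrightarrow> w = w'"
begin

lemma reversed_ends_iff:
  "(x, y) \<in> arcs_ends (reverse_arcs R G M) \<longleftrightarrow>
    (\<exists>w. (x, w, y) \<in> arcs G - M) \<or> (\<exists>w. (y, w, x) \<in> M)"
proof
  assume "(x, y) \<in> arcs_ends (reverse_arcs R G M)"
  then show "(\<exists>w. (x, w, y) \<in> arcs G - M) \<or> (\<exists>w. (y, w, x) \<in> M)"
    by (auto simp: arcs_ends_conv reverse_arcs_def tail_G head_G)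
next
  let ?H = "reverse_arcs R G M"
  assume "(\<exists>w. (x, w, y) \<in> arcs G - M) \<or> (\<exists>w. (y, w, x) \<in> M)"
  then have "\<exists>w. (x, w, y) \<in> arcs ?H"
    unfolding reverse_arcs_def by (simp del: split_paired_Ex) blast
  then obtain w where "(x, w, y) \<in> arcs ?H" ..
  then have "(tail ?H (x, w, y), head ?H (x, w, y)) \<in> arcs_ends ?H"
    unfolding arcs_ends_conv by (rule imageI)
  then show "(x, y) \<in> arcs_ends ?H"
    by (simp add: reverse_arcs_def tail_G head_G)
qed

lemma vertex_disjointD:
  assumes "vertex_disjoint G M" "(v, w, u) \<in> M" "(v', w', u') \<in> M" "{v, u} \<inter> {v', u'} \<noteq> {}"
  shows "v = v' \<and> w = w' \<and> u = u'"
  using assms(1)[unfolded vertex_disjoint_def, rule_format, OF assms(2,3)] assms(4)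
  by (auto simp: tail_G head_G)

text \<open>
  The only way to gain degree over two steps is to follow two reversed arcs in a row, and these would
  share the middle vertex.
\<close>

lemma two_steps_degree:
  assumes M: "M \<subseteq> arcs G" "vertex_disjoint G M"
    and xy: "(x, y) \<in> arcs_ends (reverse_arcs R G M)"
    and yz: "(y, z) \<in> arcs_ends (reverse_arcs R G M)"
  shows "fst z \<le> fst x"
proof (cases "\<exists>w w'. (y, w, x) \<in> M \<and> (z, w', y) \<in> M")
  case True
  then obtain w w' where "(y, w, x) \<in> M" "(z, w', y) \<in> M" by blast
  with vertex_disjointD[OF M(2) this] have "(y, w, y) \<in> arcs G" using M(1) by auto
  then show ?thesis using arc_degree[of y w y] by simp
next
  case False
  have "fst x = Suc (fst y) \<or> (\<exists>w. (y, w, x) \<in> M) \<and> fst y = Suc (fst x)"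
    using xy arc_degree M(1) unfolding reversed_ends_iff by blast
  moreover have "fst y = Suc (fst z) \<or> (\<exists>w. (z, w, y) \<in> M) \<and> fst z = Suc (fst y)"
    using yz arc_degree M(1) unfolding reversed_ends_iff by blast
  ultimately show ?thesis using False by auto
qed

text \<open>
  Along the even positions of an infinite walk the degree is a nonincreasing sequence of natural
  numbers, hence eventually constant, and from there on the walk is one of the excluded paths.
\<close>

lemma wf_reversed_ends:
  assumes M: "M \<subseteq> arcs G" "vertex_disjoint G M"
    and no_path: "\<nexists>p k. (\<forall>i. (p i, p (Suc i)) \<in> arcs_ends (reverse_arcs R G M)) \<and>
      (\<forall>i. fst (p (2 * i)) = k)"
  shows "wf ((arcs_ends (reverse_arcs R G M))\<inverse>)"
  unfolding wf_iff_no_infinite_down_chain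
proof
  assume "\<exists>p. \<forall>i. (p (Suc i), p i) \<in> (arcs_ends (reverse_arcs R G M))\<inverse>"
  then obtain p where p: "\<And>i. (p i, p (Suc i)) \<in> arcs_ends (reverse_arcs R G M)" by auto
  let ?deg = "\<lambda>i. fst (p (2 * i))"
  have decseq: "?deg j \<le> ?deg i" if "i \<le> j" for i j
    using that
  proof (induction j rule: dec_induct)
    case (step j)
    have "?deg (Suc j) \<le> ?deg j"
      using two_steps_degree[OF M p p, of "2 * j"] by simp
    with step.IH show ?case by simp
  qed simp
  \<comment> \<open>The tail of the walk from where the even positions reach their least degree stays in it.\<close>
  obtain n where n: "\<And>i. ?deg n \<le> ?deg i"
    using ex_has_least_nat[of "\<lambda>_. True" 0 ?deg] by auto
  have "\<forall>i. fst (p (2 * i + 2 * n)) = ?deg n"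
    using n decseq by (metis add.commute distrib_left le_add1 le_antisym)
  moreover have "\<forall>i. (p (i + 2 * n), p (Suc i + 2 * n)) \<in> arcs_ends (reverse_arcs R G M)"
    using p by simp
  ultimately show False
    using no_path by (elim notE) (intro exI[of _ "\<lambda>i. p (i + 2 * n)"] exI[of _ "?deg n"] conjI)
qed

text \<open>
  One well-foundedness condition replaces the two global conditions on a Morse matching, and a
  well-founded relation on a finite set extends to a total order.
\<close>

lemma morse_matching_iff_wf:
  "morse_matching R G M \<longleftrightarrow>
    M \<subseteq> arcs G \<and> vertex_disjoint G M \<and> (\<forall>(v, w, u)\<in>M. w \<in> Units R) \<and>
    wf ((arcs_ends (reverse_arcs R G M))\<inverse>)"
proof -
  let ?H = "reverse_arcs R G M"
  let ?no_path = "\<nexists>p k. (\<forall>i. (p i, p (Suc i)) \<in> arcs_ends ?H) \<and> (\<forall>i. fst (p (2 * i)) = k)"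
  have acyclic_iff: "(\<nexists>p. pre_digraph.cycle ?H p) \<and> ?no_path \<longleftrightarrow> wf ((arcs_ends ?H)\<inverse>)"
    if "M \<subseteq> arcs G" "vertex_disjoint G M"
  proof
    assume "(\<nexists>p. pre_digraph.cycle ?H p) \<and> ?no_path"
    then show "wf ((arcs_ends ?H)\<inverse>)" using wf_reversed_ends[OF that] by simp
  next
    assume wf: "wf ((arcs_ends ?H)\<inverse>)"
    then have "?no_path" unfolding wf_iff_no_infinite_down_chain by auto
    with wf_imp_no_cycle[OF wf] show "(\<nexists>p. pre_digraph.cycle ?H p) \<and> ?no_path" by simp
  qed
  show ?thesis
    unfolding morse_matching_def vertex_disjoint_def[symmetric]
    by (rule iffI; elim conjE; intro conjI) (simp_all add: acyclic_iff[symmetric])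
qed

section \<open>Steepness pairings are Morse matchings\<close>

text \<open>
  Exactly one of the two steps is reversed: if \<open>y\<close> lies above \<open>x\<close> and \<open>z\<close> it is the first, and
  \<open>z < x\<close> because \<open>x\<close> is the greatest face of \<open>y\<close>; if \<open>y\<close> lies below, it is the second, and
  \<open>z < x\<close> because \<open>z\<close> is the least coface of \<open>y\<close>.
\<close>

lemma steepness_two_steps_decrease:
  assumes xy: "(x, y) \<in> arcs_ends (reverse_arcs R G (steepness_pairing R G r))"
    and yz: "(y, z) \<in> arcs_ends (reverse_arcs R G (steepness_pairing R G r))"
    and deg: "fst x = fst z"
  shows "(z, x) \<in> r - Id"
proof -
  let ?M = "steepness_pairing R G r"
  have sub: "?M \<subseteq> arcs G" by (auto simp: steepness_pairing_def)
  consider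
    (above) w w' where "(y, w, x) \<in> ?M" "(y, w', z) \<in> arcs G - ?M"
    | (below) w w' where "(x, w, y) \<in> arcs G - ?M" "(z, w', y) \<in> ?M"
    | (down) w w' where "(x, w, y) \<in> arcs G" "(y, w', z) \<in> arcs G"
    | (up) w w' where "(y, w, x) \<in> ?M" "(z, w', y) \<in> ?M"
    using xy yz unfolding reversed_ends_iff by blast
  then show ?thesis
  proof cases
    case above
    have "z \<noteq> x" using above sub arc_weight_unique[of y w x w'] by blast
    with above show ?thesis unfolding steepness_pairing_def by blast
  next
    case below
    have "x \<noteq> z" using below sub arc_weight_unique[of z w' y w] by blast
    with below show ?thesis unfolding steepness_pairing_def by blast
  next
    case down
    then show ?thesis using deg arc_degree[of x w y] arc_degree[of y w' z] by simp
  next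
    case up
    then have "(y, w, x) \<in> arcs G" "(z, w', y) \<in> arcs G" using sub by blast+
    then show ?thesis using deg arc_degree[of y w x] arc_degree[of z w' y] by simp
  qed
qed

lemma steepness_pairing_morse:
  assumes wf: "wf (r - Id)" and disj: "vertex_disjoint G (steepness_pairing R G r)"
  shows "morse_matching R G (steepness_pairing R G r)"
proof -
  let ?M = "steepness_pairing R G r"
  have "\<nexists>p k. (\<forall>i. (p i, p (Suc i)) \<in> arcs_ends (reverse_arcs R G ?M)) \<and>
      (\<forall>i. fst (p (2 * i)) = k)"
  proof (intro notI, elim exE conjE)
    fix p k
    assume p: "\<forall>i. (p i, p (Suc i)) \<in> arcs_ends (reverse_arcs R G ?M)"
      and k: "\<forall>i. fst (p (2 * i)) = k"
    have "(p (2 * Suc i), p (2 * i)) \<in> r - Id" for i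
    proof (rule steepness_two_steps_decrease)
      show "(p (2 * i), p (Suc (2 * i))) \<in> arcs_ends (reverse_arcs R G ?M)" using p by blast
      show "(p (Suc (2 * i)), p (2 * Suc i)) \<in> arcs_ends (reverse_arcs R G ?M)"
        using p[rule_format, of "Suc (2 * i)"] by simp
      show "fst (p (2 * i)) = fst (p (2 * Suc i))" using k by metis
    qed
    then have "\<exists>q. \<forall>i. (q (Suc i), q i) \<in> r - Id"
      by (intro exI[of _ "\<lambda>i. p (2 * i)"]) simp
    with wf show False unfolding wf_iff_no_infinite_down_chain by (rule notE)
  qed
  moreover have "?M \<subseteq> arcs G" by (auto simp: steepness_pairing_def)
  ultimately have "wf ((arcs_ends (reverse_arcs R G ?M))\<inverse>)"
    using disj by (intro wf_reversed_ends) auto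
  then show ?thesis
    using disj \<open>?M \<subseteq> arcs G\<close> unfolding morse_matching_iff_wf
    by (auto simp: steepness_pairing_def)
qed

text \<open>
  Of two steep arcs with a common tail each head would be strictly below the other one, and dually
  for a common head.
\<close>

lemma steepness_vertex_disjoint:
  assumes "antisym r"
    and no_consecutive: "\<And>y w v w' u. (y, w, v) \<in> steepness_pairing R G r \<Longrightarrow>
      (v, w', u) \<notin> steepness_pairing R G r"
  shows "vertex_disjoint G (steepness_pairing R G r)"
proof -
  let ?M = "steepness_pairing R G r"
  have same_tail: "u = u'" if "(v, w, u) \<in> ?M" "(v, w', u') \<in> ?M" for v w u w' u'
  proof (rule ccontr)
    assume "u \<noteq> u'"
    with that have "(u', u) \<in> r" "(u, u') \<in> r" unfolding steepness_pairing_def by blast+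
    with \<open>u \<noteq> u'\<close> \<open>antisym r\<close> show False by (auto dest: antisymD)
  qed
  have same_head: "v = v'" if "(v, w, u) \<in> ?M" "(v', w', u) \<in> ?M" for v w u w' v'
  proof (rule ccontr)
    assume "v \<noteq> v'"
    with that have "(v', v) \<in> r" "(v, v') \<in> r" unfolding steepness_pairing_def by blast+
    with \<open>v \<noteq> v'\<close> \<open>antisym r\<close> show False by (auto dest: antisymD)
  qed
  have weight: "w = w'" if "(v, w, u) \<in> ?M" "(v, w', u) \<in> ?M" for v w u w'
    using that arc_weight_unique[of v w u w'] by (simp add: steepness_pairing_def)
  show ?thesis
    unfolding vertex_disjoint_def
  proof (intro ballI impI)
    fix e f
    assume "e \<in> ?M" "f \<in> ?M" "e \<noteq> f"
    moreover obtain v w u where e: "e = (v, w, u)" by (cases e)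
    moreover obtain v' w' u' where f: "f = (v', w', u')" by (cases f)
    ultimately have "v \<noteq> v'" "u \<noteq> u'" "v \<noteq> u'" "u \<noteq> v'"
      using same_tail same_head weight no_consecutive by metis+
    then show "{tail G e, head G e} \<inter> {tail G f, head G f} = {}"
      by (simp add: e f tail_G head_G)
  qed
qed

section \<open>Every Morse matching consists of steep arcs\<close>

text \<open>
  Any arc other than \<open>v \<rightarrow> u\<close> at \<open>v\<close> or \<open>u\<close> is unmatched, so it keeps its direction and composes
  with the reversed arc \<open>u \<rightarrow> v\<close> to a walk between two vertices of equal degree.
\<close>

lemma morse_matching_subset_steepness:
  assumes M: "morse_matching R G M"
    and r: "\<And>x y. (x, y) \<in> (arcs_ends (reverse_arcs R G M))\<^sup>+ \<Longrightarrow> fst x = fst y \<Longrightarrow>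
      (y, x) \<in> r - Id"
  shows "M \<subseteq> steepness_pairing R G r"
proof
  fix e assume "e \<in> M"
  moreover obtain v w u where e: "e = (v, w, u)" by (cases e)
  ultimately have vu: "(v, w, u) \<in> M" by simp
  have sub: "M \<subseteq> arcs G" and disj: "vertex_disjoint G M" and unit: "w \<in> Units R"
    using M vu by (auto simp: morse_matching_iff_wf)
  have uv: "(u, v) \<in> arcs_ends (reverse_arcs R G M)"
    using vu by (auto simp: reversed_ends_iff)
  have vu_arc: "(v, w, u) \<in> arcs G" using vu sub by blast
  have "(x, u) \<in> r - Id" if "(v, w', x) \<in> arcs G" "x \<noteq> u" for x w'
  proof (rule r)
    have "(v, w', x) \<notin> M" using vertex_disjointD[OF disj vu] that(2) by blast
    then have "(v, x) \<in> arcs_ends (reverse_arcs R G M)"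
      using that(1) by (auto simp: reversed_ends_iff)
    with uv show "(u, x) \<in> (arcs_ends (reverse_arcs R G M))\<^sup>+" by (meson r_into_trancl trancl.intros)
    show "fst u = fst x" using arc_degree[OF that(1)] arc_degree[OF vu_arc] by simp
  qed
  moreover have "(v, y) \<in> r - Id" if "(y, w', u) \<in> arcs G" "y \<noteq> v" for y w'
  proof (rule r)
    have "(y, w', u) \<notin> M" using vertex_disjointD[OF disj vu] that(2) by blast
    then have "(y, u) \<in> arcs_ends (reverse_arcs R G M)"
      using that(1) by (auto simp: reversed_ends_iff)
    with uv show "(y, v) \<in> (arcs_ends (reverse_arcs R G M))\<^sup>+" by (meson r_into_trancl trancl.intros)
    show "fst y = fst v" using arc_degree[OF that(1)] arc_degree[OF vu_arc] by simp
  qed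
  ultimately show "e \<in> steepness_pairing R G r"
    using vu_arc unit unfolding e steepness_pairing_def by blast
qed

end

text \<open>
  Number the elements of \<open>V\<close> by repeatedly removing a minimal one.
\<close>

lemma finite_wf_linear_extension:
  assumes "finite V" "wf r"
  shows "\<exists>f :: 'v \<Rightarrow> nat. inj_on f V \<and> (\<forall>x\<in>V. \<forall>y\<in>V. (x, y) \<in> r \<longrightarrow> f x < f y)"
  using assms(1)
proof (induction V rule: finite_psubset_induct)
  case (psubset V)
  show ?case
  proof (cases "V = {}")
    case False
    with assms(2) obtain m where m: "m \<in> V" "\<And>y. (y, m) \<in> r \<Longrightarrow> y \<notin> V"
      by (metis wfE_min ex_in_conv)
    then have "V - {m} \<subset> V" by blast
    with psubset.IH obtain f :: "'v \<Rightarrow> nat" where f: "inj_on f (V - {m})"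
      "\<And>x y. x \<in> V - {m} \<Longrightarrow> y \<in> V - {m} \<Longrightarrow> (x, y) \<in> r \<Longrightarrow> f x < f y"
      by meson
    define g where "g x = (if x = m then 0 else Suc (f x))" for x
    have "inj_on g V" using f(1) by (auto simp: inj_on_def g_def)
    moreover have "g x < g y" if "x \<in> V" "y \<in> V" "(x, y) \<in> r" for x y
      using f(2)[of x y] m(2)[of x] that by (auto simp: g_def)
    ultimately show ?thesis by blast
  qed auto
qed

section \<open>The digraph of a based chain complex\<close>

context based_chain_complex
begin

lemma graded_digraph_complex: "graded_digraph (complex_digraph R C N d I)"
  by unfold_locales (auto simp: complex_digraph_def)

lemma complex_arc_iff:
  "((k, v), w, (l, u)) \<in> arcs (complex_digraph R C N d I) \<longleftrightarrow>
    k = Suc l \<and> l < N \<and> u \<in> I l \<and> v \<in> I (Suc l) \<and>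
    w = boundary_entry R C d I (Suc l) u v \<and> w \<noteq> \<zero>"
  unfolding complex_digraph_def by (cases k) auto

lemma finite_order_union:
  assumes "total_orders N I ords"
  shows "finite (order_union N ords)"
proof (rule finite_subset)
  have "ords k \<subseteq> I k \<times> I k" if "k \<le> N" for k
    using assms that by (auto simp: total_orders_def order_on_defs)
  then show "order_union N ords \<subseteq> (SIGMA k:{0..N}. I k) \<times> (SIGMA k:{0..N}. I k)"
    unfolding order_union_def by fastforce
  show "finite ((SIGMA k:{0..N}. I k) \<times> (SIGMA k:{0..N}. I k))"
    using finite_I by (intro finite_cartesian_product finite_SigmaI) auto
qed

lemma trans_antisym_order_union:
  assumes "total_orders N I ords"
  shows "trans (order_union N ords)" "antisym (order_union N ords)"
proof -
  have tr: "trans (ords k)" and anti: "antisym (ords k)" if "k \<le> N" for k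
    using assms that by (auto simp: total_orders_def order_on_defs)
  show "trans (order_union N ords)"
    unfolding order_union_def by (rule transI) (auto intro: transD[OF tr])
  show "antisym (order_union N ords)"
    unfolding order_union_def by (rule antisymI) (auto dest: antisymD[OF anti])
qed

lemma wf_order_union:
  assumes "total_orders N I ords"
  shows "wf (order_union N ords - Id)"
proof (rule finite_acyclic_wf)
  show "finite (order_union N ords - Id)" using finite_order_union[OF assms] by simp
  show "acyclic (order_union N ords - Id)"
    using trans_antisym_order_union[OF assms] by (simp add: acyclic_irrefl trans_diff_Id)
qed

text \<open>
  A face \<open>x\<close> of \<open>y\<close> other than \<open>v\<close> lies below \<open>v\<close> and a coface \<open>x\<close> of \<open>u\<close> other than \<open>v\<close> lies above
  \<open>v\<close>. Hence only \<open>x = v\<close> contributes to the sum that expresses \<open>\<partial>\<^sup>2 = 0\<close>.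
\<close>

lemma steepness_no_consecutive:
  assumes ords: "total_orders N I ords"
    and yv: "(y, w, v) \<in> steepness_pairing R (complex_digraph R C N d I) (order_union N ords)"
    and vu: "(v, w', u) \<in> steepness_pairing R (complex_digraph R C N d I) (order_union N ords)"
  shows False
proof -
  let ?G = "complex_digraph R C N d I"
  obtain k1 y' where y: "y = (k1, y')" by (cases y)
  obtain k2 v' where v: "v = (k2, v')" by (cases v)
  obtain k u' where u: "u = (k, u')" by (cases u)
  let ?c = "\<lambda>x. boundary_entry R C d I (Suc (Suc k)) x y'"
  let ?e = "\<lambda>x. boundary_entry R C d I (Suc k) u' x"
  have arcs: "(y, w, v) \<in> arcs ?G" "(v, w', u) \<in> arcs ?G"
    and units: "w \<in> Units R" "w' \<in> Units R"
    using yv vu by (auto simp: steepness_pairing_def)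
  have deg: "k2 = Suc k" "k1 = Suc (Suc k)" and k: "Suc k < N"
    and mem: "y' \<in> I (Suc (Suc k))" "v' \<in> I (Suc k)" "u' \<in> I k"
    and w: "w = ?c v'" "w' = ?e v'" "w \<noteq> \<zero>"
    using arcs by (auto simp: y v u complex_arc_iff)
  have closed: "?c x \<in> carrier R" "?e x \<in> carrier R" if "x \<in> I (Suc k)" for x
    using boundary_entry_carrier k mem that by auto
  have other: "?c x \<otimes> ?e x = \<zero>" if x: "x \<in> I (Suc k)" "x \<noteq> v'" for x
  proof (rule ccontr)
    assume nz: "?c x \<otimes> ?e x \<noteq> \<zero>"
    then have "?c x \<noteq> \<zero>" "?e x \<noteq> \<zero>" using closed[OF x(1)] by auto
    then have "(y, ?c x, (Suc k, x)) \<in> arcs ?G" "((Suc k, x), ?e x, u) \<in> arcs ?G"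
      using k mem x by (auto simp: y u deg complex_arc_iff)
    then have "((Suc k, x), v) \<in> order_union N ords" "(v, (Suc k, x)) \<in> order_union N ords"
      using yv vu x(2) unfolding steepness_pairing_def v by blast+
    with trans_antisym_order_union(2)[OF ords] x(2) show False
      by (auto simp: v dest: antisymD)
  qed
  have "\<zero> = (\<Oplus>x\<in>I (Suc k). ?c x \<otimes> ?e x)"
    using boundary_entry_product[OF k mem(1,3)] by simp
  also have "\<dots> = (\<Oplus>x\<in>I (Suc k). if v' = x then ?c x \<otimes> ?e x else \<zero>)"
    using other closed by (intro R.finsum_cong') auto
  also have "\<dots> = ?c v' \<otimes> ?e v'"
    using mem(2) closed finite_I[of "Suc k"] k by (intro R.finsum_singleton) auto
  finally have "w \<otimes> w' = \<zero>" using w by simp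
  then have "w = \<zero>"
    using units by (metis R.Units_closed R.Units_r_inv R.Units_inv_closed R.m_assoc R.l_null R.r_one)
  with w show False by simp
qed

lemma steepness_pairing_morse_complex:
  assumes "total_orders N I ords"
  shows "morse_matching R (complex_digraph R C N d I)
    (steepness_pairing R (complex_digraph R C N d I) (order_union N ords))"
proof -
  interpret graded_digraph R "complex_digraph R C N d I" by (rule graded_digraph_complex)
  show ?thesis
    using assms steepness_no_consecutive trans_antisym_order_union(2) wf_order_union
    by (intro steepness_pairing_morse steepness_vertex_disjoint) blast+
qed

lemma morse_matching_subset_steepness_complex:
  assumes M: "morse_matching R (complex_digraph R C N d I) M"
  shows "\<exists>ords. total_orders N I ords \<and>
    M \<subseteq> steepness_pairing R (complex_digraph R C N d I) (order_union N ords)"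
proof -
  let ?G = "complex_digraph R C N d I"
  let ?A = "arcs_ends (reverse_arcs R ?G M)"
  let ?V = "SIGMA k:{0..N}. I k"
  interpret graded_digraph R ?G by (rule graded_digraph_complex)
  have sub: "M \<subseteq> arcs ?G" and wf: "wf (?A\<inverse>)"
    using M by (auto simp: morse_matching_iff_wf)
  have "finite ?V" using finite_I by (intro finite_SigmaI) auto
  then obtain f :: "nat \<times> 'b \<Rightarrow> nat" where inj: "inj_on f ?V"
    and mono: "\<And>x y. x \<in> ?V \<Longrightarrow> y \<in> ?V \<Longrightarrow> (x, y) \<in> (?A\<inverse>)\<^sup>+ \<Longrightarrow> f x < f y"
    using finite_wf_linear_extension[OF _ wf_trancl[OF wf]] by metis
  define ords where "ords k = {(x, y). x \<in> I k \<and> y \<in> I k \<and> f (k, x) \<le> f (k, y)}" for k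
  have "total_orders N I ords"
    unfolding total_orders_def
  proof (intro allI impI)
    fix k assume k: "k \<le> N"
    have "x = y" if "x \<in> I k" "y \<in> I k" "f (k, x) = f (k, y)" for x y
      using inj_onD[OF inj that(3)] that k by simp
    then show "linear_order_on (I k) (ords k)"
      unfolding order_on_defs ords_def
      by (auto simp: refl_on_def total_on_def intro!: transI antisymI)
  qed
  moreover have "M \<subseteq> steepness_pairing R ?G (order_union N ords)"
  proof (rule morse_matching_subset_steepness[OF M])
    fix x y assume xy: "(x, y) \<in> ?A\<^sup>+" and deg: "fst x = fst y"
    have "?A \<subseteq> ?V \<times> ?V"
    proof
      fix e assume e: "e \<in> ?A"
      obtain a b where ab: "e = (a, b)" by (cases e)
      have V: "a \<in> ?V" "b \<in> ?V" if "(a, w, b) \<in> arcs ?G" for a w b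
        using that by (cases a; cases b; simp add: complex_arc_iff)+
      from e ab consider w where "(a, w, b) \<in> arcs ?G" | w where "(b, w, a) \<in> arcs ?G"
        using sub by (auto simp: reversed_ends_iff)
      then show "e \<in> ?V \<times> ?V" using V ab by cases blast+
    qed
    then have "x \<in> ?V" "y \<in> ?V" using xy trancl_subset_Sigma by blast+
    moreover from this have "f y < f x" using xy by (intro mono) (auto simp: trancl_converse)
    ultimately show "(y, x) \<in> order_union N ords - Id"
      using deg by (cases x; cases y) (auto simp: order_union_def ords_def)
  qed
  ultimately show ?thesis by blast
qed

end

theorem lemma2p2:
  fixes R :: "('a, 'm) ring_scheme"
    and C :: "nat \<Rightarrow> ('a, 'b, 'n) module_scheme"
    and N :: nat
    and d :: "nat \<Rightarrow> 'b \<Rightarrow> 'b"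
    and I :: "nat \<Rightarrow> 'b set"
  assumes "based_chain_complex R C N d I"
  defines "G \<equiv> complex_digraph R C N d I"
  shows "(\<forall>ords. total_orders N I ords \<longrightarrow>
            morse_matching R G (steepness_pairing R G (order_union N ords))) \<and>
         (\<forall>M. morse_matching R G M \<longrightarrow>
            (\<exists>ords. total_orders N I ords \<and> M \<subseteq> steepness_pairing R G (order_union N ords))) \<and>
         {M. maximal_morse_matching R G M} \<subseteq>
           {steepness_pairing R G (order_union N ords) | ords. total_orders N I ords}"
proof -
  note a = based_chain_complex.steepness_pairing_morse_complex[OF assms(1), folded G_def]
  note b = based_chain_complex.morse_matching_subset_steepness_complex[OF assms(1), folded G_def]
  have "\<exists>ords. M = steepness_pairing R G (order_union N ords) \<and> total_orders N I ords"
    if "maximal_morse_matching R G M" for M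
    using that a b unfolding maximal_morse_matching_def by metis
  with a b show ?thesis by blast
qed

end
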